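(* Let $\Phi_+$ be a vector space of finite dimension $d$ over a field, with basis $\mathcal{B}=\{x_1,\ldots,x_d\}$. Choose a basis $\mathcal{B}^{\wedge}$ for $\bigwedge\Phi_+$ made up of exterior products (including the empty product, which is taken to equal $1$) of the elements of $\mathcal{B}$. Similarly choose a basis $\mathcal{B}^{\top\wedge}$ for $\bigwedge\Phi_+^{\top}$ made up of exterior products of the elements of the dual basis $\mathcal{B}^{\top}=\{x_1^{\top},\ldots,x_d^{\top}\}$. Let $H:\bigwedge\Phi_+\rightarrow\bigwedge\Phi_+^{\top}$ be the vector space map such that for each $x_{i_1}\wedge\cdots\wedge x_{i_n}\in\mathcal{B}^{\wedge}$ $$H(x_{i_1}\wedge\cdots\wedge x_{i_n})=(-1)^{\rho}\cdot x_{i_{n+1}}^{\top}\wedge\cdots\wedge x_{i_d}^{\top}$$ where $x_{i_{n+1}}^{\top}\wedge\cdots\wedge x_{i_d}^{\top}\in\mathcal{B}^{\top\wedge}$, $\{i_1,\ldots,i_n\}\cup\{i_{n+1},\ldots,i_d\}=\{1,\ldots,d\}$, and $$\rho=\begin{pmatrix}1&\cdots&d\\ i_1&\cdots&i_d\end{pmatrix}.$$ Then $H$ is a vector space isomorphism that sends each blade to a corresponding annihilator blade.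
   Context: $\Phi_+^{\top}$ is the dual space of $\Phi_+$, and $x_i^{\top}$ is the coordinate function with $x_i^{\top}(x_j)=\delta_{i,j}$. $(-1)^{\rho}=+1$ or $-1$ according as the permutation $\rho$ is even or odd. The bases $\mathcal{B}^{\wedge}$ and $\mathcal{B}^{\top\wedge}$ contain, for each subset of the index set $\{1,\ldots,d\}$, exactly one exterior product of the corresponding (dual) basis vectors, in some chosen order. An $n$-blade in an exterior algebra is a nonzero exterior product $v_1\wedge\cdots\wedge v_n$ of $n$ vectors (so $v_1,\ldots,v_n$ are independent); it represents the $n$-dimensional subspace spanned by $v_1,\ldots,v_n$. The nonzero scalars are the $0$-blades and represent the subspace $\{0\}$. For a subspace $\mathcal{W}$ of $\Phi_+$, its annihilator is $\mathcal{W}^0=\{f\in\Phi_+^{\top}\mid f(w)=0\text{ for all }w\in\mathcal{W}\}$. If a blade in $\bigwedge\Phi_+$ represents $\mathcal{W}$, a corresponding annihilator blade is any blade in $\bigwedge\Phi_+^{\top}$ that represents $\mathcal{W}^0$. *)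

theory Defs
  imports
    Complex_Main
    "HOL-Library.Function_Algebras"
    "HOL-Library.Poly_Mapping"
    "HOL-Combinatorics.Permutations"
begin

section \<open>The free associative algebra on a set of vectors\<close>

text \<open>
  The free monoid on \<open>'v\<close>. Its monoid algebra \<open>'v word \<Rightarrow>\<^sub>0 'k\<close>, which carries the convolution
  product of \<^theory>\<open>HOL-Library.Poly_Mapping\<close>, is the free associative unital algebra over \<open>'k\<close> on
  the underlying set of \<open>'v\<close>.
\<close>

datatype 'v word = Word (letters: "'v list")

instantiation word :: (type) monoid_add
begin

definition zero_word :: "'a word" where
  "0 = Word []"

definition plus_word :: "'a word \<Rightarrow> 'a word \<Rightarrow> 'a word" where
  "u + w = Word (letters u @ letters w)"

instance
  by intro_classes (simp_all add: zero_word_def plus_word_def)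

end

definition free_algebra :: "'v set \<Rightarrow> ('v word \<Rightarrow>\<^sub>0 'k::field) set" where
  "free_algebra V = {p. \<forall>w \<in> Poly_Mapping.keys p. set (letters w) \<subseteq> V}"

definition free_gen :: "'v \<Rightarrow> ('v word \<Rightarrow>\<^sub>0 'k::field)" where
  "free_gen v = Poly_Mapping.single (Word [v]) 1"

section \<open>Exterior algebras\<close>

text \<open>
  The two-sided ideal of \<open>free_algebra V\<close> whose quotient is the exterior algebra of the subspace \<open>V\<close>.
  The relations \<open>add\<close> and \<open>scale\<close> turn the free algebra on the set \<open>V\<close> into the tensor algebra of
  the vector space \<open>V\<close>; the relation \<open>square\<close> kills \<open>v \<otimes> v\<close>.
\<close>

inductive_set exterior_ideal ::
    "('k::field \<Rightarrow> 'v::ab_group_add \<Rightarrow> 'v) \<Rightarrow> 'v set \<Rightarrow> ('v word \<Rightarrow>\<^sub>0 'k) set"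
  for s :: "'k \<Rightarrow> 'v \<Rightarrow> 'v" and V :: "'v set"
where
  add: "u \<in> V \<Longrightarrow> v \<in> V \<Longrightarrow> free_gen (u + v) - free_gen u - free_gen v \<in> exterior_ideal s V"
| scale: "v \<in> V \<Longrightarrow> free_gen (s c v) - Poly_Mapping.single 0 c * free_gen v \<in> exterior_ideal s V"
| square: "v \<in> V \<Longrightarrow> free_gen v * free_gen v \<in> exterior_ideal s V"
| zero: "0 \<in> exterior_ideal s V"
| sum: "p \<in> exterior_ideal s V \<Longrightarrow> q \<in> exterior_ideal s V \<Longrightarrow> p + q \<in> exterior_ideal s V"
| left: "p \<in> free_algebra V \<Longrightarrow> q \<in> exterior_ideal s V \<Longrightarrow> p * q \<in> exterior_ideal s V"
| right: "p \<in> free_algebra V \<Longrightarrow> q \<in> exterior_ideal s V \<Longrightarrow> q * p \<in> exterior_ideal s V"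

text \<open>
  In an exterior algebra the ring multiplication is the exterior product, \<open>1\<close> is the empty product,
  and \<open>\<iota>\<close> embeds the vectors.
\<close>

definition wedge :: "('v \<Rightarrow> 'a::ring_1) \<Rightarrow> 'v list \<Rightarrow> 'a" where
  "wedge \<iota> vs = prod_list (map \<iota> vs)"

text \<open>The extension of \<open>\<iota>\<close> to an algebra homomorphism on the free algebra.\<close>

definition free_eval ::
    "('k::field \<Rightarrow> 'a::ring_1 \<Rightarrow> 'a) \<Rightarrow> ('v \<Rightarrow> 'a) \<Rightarrow> ('v word \<Rightarrow>\<^sub>0 'k) \<Rightarrow> 'a" where
  "free_eval sA \<iota> p =
     (\<Sum>w \<in> Poly_Mapping.keys p. sA (Poly_Mapping.lookup p w) (wedge \<iota> (letters w)))"

text \<open>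
  \<open>(sA, \<iota>)\<close> makes the type \<open>'a\<close> an exterior algebra of the vector space \<open>V\<close>: a unital associative
  algebra that \<open>free_eval sA \<iota>\<close> identifies with \<open>free_algebra V\<close> modulo \<open>exterior_ideal s V\<close>.
  This determines \<open>'a\<close>, together with \<open>\<iota>\<close> on \<open>V\<close>, up to a unique isomorphism. The space \<open>V\<close> may be a proper
  subspace of its ambient type, in which case the values of \<open>\<iota>\<close> off \<open>V\<close> are irrelevant.
\<close>

locale exterior_algebra =
  base: vector_space s + alg: vector_space sA
  for s :: "'k::field \<Rightarrow> 'v::ab_group_add \<Rightarrow> 'v"
    and V :: "'v set"
    and sA :: "'k \<Rightarrow> 'a::ring_1 \<Rightarrow> 'a"
    and \<iota> :: "'v \<Rightarrow> 'a" +
  assumes subspace: "base.subspace V"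
    and scale_mult_left: "sA c a * b = sA c (a * b)"
    and scale_mult_right: "a * sA c b = sA c (a * b)"
    and free_eval_surj: "free_eval sA \<iota> ` free_algebra V = UNIV"
    and free_eval_kernel:
      "p \<in> free_algebra V \<Longrightarrow> free_eval sA \<iota> p = 0 \<longleftrightarrow> p \<in> exterior_ideal s V"

section \<open>Blades\<close>

text \<open>\<open>a\<close> is an \<open>n\<close>-blade in the exterior algebra of \<open>V\<close>, and it represents the subspace \<open>U\<close> of \<open>V\<close>.\<close>

definition blade_represents ::
    "('k::field \<Rightarrow> 'v::ab_group_add \<Rightarrow> 'v) \<Rightarrow> 'v set \<Rightarrow> ('k \<Rightarrow> 'a::ring_1 \<Rightarrow> 'a) \<Rightarrow> ('v \<Rightarrow> 'a)
      \<Rightarrow> nat \<Rightarrow> 'a \<Rightarrow> 'v set \<Rightarrow> bool" where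
  "blade_represents s V sA \<iota> n a U \<longleftrightarrow>
     (if n = 0 then (\<exists>c. c \<noteq> 0 \<and> a = sA c 1) \<and> U = {0}
      else \<exists>vs. length vs = n \<and> set vs \<subseteq> V \<and> a = wedge \<iota> vs \<and> a \<noteq> 0 \<and> U = module.span s (set vs))"

section \<open>Dual space and annihilators\<close>

definition dual_space :: "('k::field \<Rightarrow> 'v::ab_group_add \<Rightarrow> 'v) \<Rightarrow> ('v \<Rightarrow> 'k) set" where
  "dual_space s = {f. Vector_Spaces.linear s (*) f}"

definition dual_scale :: "'k::field \<Rightarrow> ('v \<Rightarrow> 'k) \<Rightarrow> 'v \<Rightarrow> 'k" where
  "dual_scale c f = (\<lambda>v. c * f v)"

definition annihilator ::
    "('k::field \<Rightarrow> 'v::ab_group_add \<Rightarrow> 'v) \<Rightarrow> 'v set \<Rightarrow> ('v \<Rightarrow> 'k) set" where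
  "annihilator s W = {f \<in> dual_space s. \<forall>w \<in> W. f w = 0}"

section \<open>Permutations in one-line notation\<close>

text \<open>The permutation that maps \<open>j\<close> to the \<open>j\<close>-th entry, counted from 1, of the list.\<close>

definition one_line_perm :: "nat list \<Rightarrow> nat \<Rightarrow> nat" where
  "one_line_perm is j = (if j \<in> {1..length is} then is ! (j - 1) else j)"

end

theory Submission
  imports Defs
begin

text \<open>
  The map \<open>H\<close> is a basis version of contracting the volume element
  \<open>\<Omega> = x\<^sub>1\<^sup>T \<and> \<dots> \<and> x\<^sub>d\<^sup>T\<close> of the dual space. The point of the proof is that this
  description is free of the basis: for every element \<open>a\<close> and every vector \<open>v\<close>,
  \<open>H (a \<and> v) = i\<^sub>v (H a)\<close>, where \<open>i\<^sub>v\<close> is the contraction by \<open>v\<close>, that is, the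
  antiderivation with \<open>i\<^sub>v f = f v\<close> (lemma \<open>H_mult_generator\<close>). By linearity this needs
  checking only for basis elements, where the signs cancel because the orders of the factors may be
  chosen freely (lemma \<open>H_index_lists\<close>).

  Given a blade \<open>v\<^sub>1 \<and> \<dots> \<and> v\<^sub>n\<close>, its vectors are independent and extend to a basis
  \<open>v\<^sub>1, \<dots>, v\<^sub>d\<close> with dual basis \<open>f\<^sub>1, \<dots>, f\<^sub>d\<close>. Since products of \<open>d\<close> functionals
  form a line, \<open>H 1 = c f\<^sub>1 \<and> \<dots> \<and> f\<^sub>d\<close>, and contracting by
  \<open>v\<^sub>1, \<dots>, v\<^sub>n\<close> in turn leaves \<open>c f\<^sub>n\<^sub>+\<^sub>1 \<and> \<dots> \<and> f\<^sub>d\<close>. These functionals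
  span the annihilator of \<open>v\<^sub>1, \<dots>, v\<^sub>n\<close>; and \<open>c\<close> is nonzero because \<open>H\<close> is injective
  (lemma \<open>H_blade\<close>).

  Injectivity follows from the same identity. It makes the kernel of \<open>H\<close> a right ideal, and a
  nonzero element can be multiplied into a nonzero multiple of \<open>x\<^sub>1 \<and> \<dots> \<and> x\<^sub>d\<close>, which is
  sent to a nonzero scalar (lemma \<open>H_kernel\<close>). Surjectivity holds because, up to sign, the
  spanning products of dual basis vectors are values of \<open>H\<close>.

  Contractions exist by the universal property of the exterior algebra, applied to triangular
  matrices of size 2 over the exterior algebra (lemma \<open>contraction_exists\<close>).
\<close>

section \<open>Evaluating the free algebra in an associative algebra\<close>

lemma wedge_simps [simp]:
  "wedge j [] = 1"
  "wedge j (v # vs) = j v * wedge j vs"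
  by (simp_all add: wedge_def)

lemma wedge_append: "wedge j (us @ vs) = wedge j us * wedge j vs"
  by (simp add: wedge_def)

lemma letters_zero [simp]: "letters 0 = []"
  by (simp add: zero_word_def)

lemma sum_keys_single:
  "(\<Sum>w\<in>Poly_Mapping.keys p. Poly_Mapping.single w (Poly_Mapping.lookup p w)) = p"
  by (rule poly_mapping_eqI)
    (simp add: lookup_sum lookup_single when_def in_keys_iff)

text \<open>
  The evaluation of the free algebra is needed in two target algebras: the exterior algebra itself,
  and the matrix algebra from which contractions are read off.
\<close>

locale unital_algebra = vector_space sR
  for sR :: "'k::field \<Rightarrow> 'r::ring_1 \<Rightarrow> 'r" +
  assumes scale_mult_left: "sR c a * b = sR c (a * b)"
    and scale_mult_right: "a * sR c b = sR c (a * b)"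
begin

lemma free_eval_superset:
  assumes "finite A" "Poly_Mapping.keys p \<subseteq> A"
  shows "free_eval sR j p = (\<Sum>w\<in>A. sR (Poly_Mapping.lookup p w) (wedge j (letters w)))"
  unfolding free_eval_def using assms
  by (intro sum.mono_neutral_left) (auto simp: in_keys_iff)

lemma free_eval_add: "free_eval sR j (p + q) = free_eval sR j p + free_eval sR j q"
proof -
  let ?A = "Poly_Mapping.keys p \<union> Poly_Mapping.keys q"
  have "Poly_Mapping.keys (p + q) \<subseteq> ?A"
    by (rule keys_add)
  then show ?thesis
    by (simp add: free_eval_superset[of ?A] lookup_add scale_left_distrib sum.distrib)
qed

lemma free_eval_zero [simp]: "free_eval sR j 0 = 0"
  by (simp add: free_eval_def)

lemma free_eval_diff: "free_eval sR j (p - q) = free_eval sR j p - free_eval sR j q"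
  using free_eval_add[of j "p - q" q] by simp

lemma free_eval_sum: "free_eval sR j (\<Sum>i\<in>A. p i) = (\<Sum>i\<in>A. free_eval sR j (p i))"
  by (induction A rule: infinite_finite_induct) (simp_all add: free_eval_add)

lemma free_eval_single [simp]:
  "free_eval sR j (Poly_Mapping.single w c) = sR c (wedge j (letters w))"
  by (subst free_eval_superset[of "{w}"]) auto

lemma free_eval_mult: "free_eval sR j (p * q) = free_eval sR j p * free_eval sR j q"
proof -
  let ?l = Poly_Mapping.lookup and ?K = Poly_Mapping.keys
  have "p * q = (\<Sum>u\<in>?K p. \<Sum>w\<in>?K q. Poly_Mapping.single (u + w) (?l p u * ?l q w))"
    by (simp add: mult_single[symmetric] sum_product[symmetric] sum_keys_single)
  then have "free_eval sR j (p * q)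
      = (\<Sum>u\<in>?K p. \<Sum>w\<in>?K q. sR (?l p u * ?l q w) (wedge j (letters (u + w))))"
    by (simp add: free_eval_sum)
  also have "\<dots> = free_eval sR j p * free_eval sR j q"
    by (simp add: free_eval_def sum_product plus_word_def wedge_append scale_mult_left
        scale_mult_right mult.commute[of "?l p _"])
  finally show ?thesis .
qed

lemma free_eval_gen [simp]: "free_eval sR j (free_gen v) = j v"
  by (simp add: free_gen_def)

lemma free_eval_one [simp]: "free_eval sR j 1 = 1"
  by (simp add: single_one[symmetric] del: single_one)

text \<open>
  Half of the universal property: since evaluation is multiplicative, it is enough that the
  generators of the ideal evaluate to \<open>0\<close>.
\<close>

lemma free_eval_exterior_ideal:
  assumes add: "\<And>u v. u \<in> V \<Longrightarrow> v \<in> V \<Longrightarrow> j (u + v) = j u + j v"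
    and scale: "\<And>c v. v \<in> V \<Longrightarrow> j (s c v) = sR c (j v)"
    and square: "\<And>v. v \<in> V \<Longrightarrow> j v * j v = 0"
    and "p \<in> exterior_ideal s V"
  shows "free_eval sR j p = 0"
  using assms(4)
  by induction
    (simp_all add: free_eval_diff free_eval_add free_eval_mult add scale square
      scale_mult_left)

end

lemma free_algebra_intros:
  "v \<in> V \<Longrightarrow> free_gen v \<in> free_algebra V"
  "1 \<in> free_algebra V"
  "0 \<in> free_algebra V"
  "Poly_Mapping.single 0 c \<in> free_algebra V"
  "p \<in> free_algebra V \<Longrightarrow> q \<in> free_algebra V \<Longrightarrow> p + q \<in> free_algebra V"
  "p \<in> free_algebra V \<Longrightarrow> q \<in> free_algebra V \<Longrightarrow> p - q \<in> free_algebra V"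
  using keys_add[of p q] keys_diff[of p q]
  by (auto simp: free_algebra_def free_gen_def zero_word_def single_one[symmetric]
      simp del: single_one split: if_splits)

lemma free_algebra_mult:
  assumes "p \<in> free_algebra V" "q \<in> free_algebra V"
  shows "p * q \<in> free_algebra V"
  using assms keys_mult[of p q] by (fastforce simp: free_algebra_def plus_word_def)

section \<open>The universal property and products of vectors\<close>

context exterior_algebra
begin

sublocale alg: unital_algebra sA
  by unfold_locales (fact scale_mult_left scale_mult_right)+

lemma
  shows generator_add: "u \<in> V \<Longrightarrow> v \<in> V \<Longrightarrow> \<iota> (u + v) = \<iota> u + \<iota> v"
    and generator_scale: "v \<in> V \<Longrightarrow> \<iota> (s c v) = sA c (\<iota> v)"
    and generator_square: "v \<in> V \<Longrightarrow> \<iota> v * \<iota> v = 0"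
proof -
  have vanish: "free_eval sA \<iota> p = 0" if "p \<in> exterior_ideal s V" "p \<in> free_algebra V" for p
    using that free_eval_kernel by blast
  show "\<iota> (u + v) = \<iota> u + \<iota> v" if "u \<in> V" "v \<in> V"
    using vanish[OF exterior_ideal.add] that base.subspace_add[OF subspace]
    by (simp add: alg.free_eval_diff free_algebra_intros diff_eq_eq add.commute)
  show "\<iota> (s c v) = sA c (\<iota> v)" if "v \<in> V"
    using vanish[OF exterior_ideal.scale] that base.subspace_scale[OF subspace]
    by (simp add: alg.free_eval_diff alg.free_eval_mult free_algebra_intros free_algebra_mult
        scale_mult_left)
  show "\<iota> v * \<iota> v = 0" if "v \<in> V"
    using vanish[OF exterior_ideal.square] that
    by (simp add: alg.free_eval_mult free_algebra_intros free_algebra_mult)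
qed

text \<open>
  Every element of the exterior algebra is the value of some free polynomial, and two polynomials
  with the same value differ by an element of the ideal, on which \<open>free_eval sR j\<close> vanishes. So
  evaluating any preimage in the target algebra does not depend on the choice.
\<close>

lemma universal_property:
  fixes sR :: "'k \<Rightarrow> 'r::ring_1 \<Rightarrow> 'r"
  assumes "unital_algebra sR"
    and j_add: "\<And>u v. u \<in> V \<Longrightarrow> v \<in> V \<Longrightarrow> j (u + v) = j u + j v"
    and j_scale: "\<And>c v. v \<in> V \<Longrightarrow> j (s c v) = sR c (j v)"
    and j_square: "\<And>v. v \<in> V \<Longrightarrow> j v * j v = 0"
  obtains \<phi> where "Vector_Spaces.linear sA sR \<phi>" "\<phi> 1 = 1"
    "\<And>a b. \<phi> (a * b) = \<phi> a * \<phi> b" "\<And>v. v \<in> V \<Longrightarrow> \<phi> (\<iota> v) = j v"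
proof -
  interpret R: unital_algebra sR
    by fact
  let ?e = "free_eval sA \<iota>" and ?j = "free_eval sR j"
  have "\<exists>p. p \<in> free_algebra V \<and> ?e p = a" for a
    using free_eval_surj by (metis UNIV_I imageE)
  then obtain r where r: "\<And>a. r a \<in> free_algebra V" "\<And>a. ?e (r a) = a"
    by metis
  define \<phi> where "\<phi> a = ?j (r a)" for a
  have eq: "\<phi> (?e p) = ?j p" if "p \<in> free_algebra V" for p
  proof -
    have "?e (r (?e p) - p) = 0"
      by (simp add: alg.free_eval_diff r)
    then have "r (?e p) - p \<in> exterior_ideal s V"
      using that r free_eval_kernel free_algebra_intros(6) by blast
    then have "?j (r (?e p) - p) = 0"
      by (rule R.free_eval_exterior_ideal[OF j_add j_scale j_square, rotated -1])
    then show ?thesis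
      by (simp add: R.free_eval_diff \<phi>_def)
  qed
  have mult: "\<phi> (a * b) = \<phi> a * \<phi> b" for a b
    using eq[of "r a * r b"]
    by (simp add: free_algebra_mult r alg.free_eval_mult R.free_eval_mult \<phi>_def)
  have "\<phi> (a + b) = \<phi> a + \<phi> b" for a b
    using eq[of "r a + r b"]
    by (simp add: free_algebra_intros r alg.free_eval_add R.free_eval_add \<phi>_def)
  moreover have "\<phi> (sA c a) = sR c (\<phi> a)" for c a
    using eq[OF free_algebra_mult[OF free_algebra_intros(4) r(1)], of c a]
    by (simp add: r alg.free_eval_mult R.free_eval_mult
        \<phi>_def scale_mult_left R.scale_mult_left)
  ultimately have "Vector_Spaces.linear sA sR \<phi>"
    by unfold_locales auto
  moreover have "\<phi> 1 = 1"
    using eq[of 1] by (simp add: free_algebra_intros)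
  moreover have "\<phi> (\<iota> v) = j v" if "v \<in> V" for v
    using eq[of "free_gen v"] that by (simp add: free_algebra_intros)
  ultimately show thesis
    using that mult by blast
qed

lemma span_wedges: "alg.span {wedge \<iota> vs | vs. set vs \<subseteq> V} = UNIV"
proof -
  have "a \<in> alg.span {wedge \<iota> vs | vs. set vs \<subseteq> V}" for a
  proof -
    obtain p where p: "p \<in> free_algebra V" "a = free_eval sA \<iota> p"
      using free_eval_surj by (metis UNIV_I imageE)
    then show ?thesis
      unfolding p(2) free_eval_def
      by (intro alg.span_sum alg.span_scale alg.span_base) (auto simp: free_algebra_def)
  qed
  then show ?thesis
    by blast
qed

lemma linear_eq_on_wedges:
  assumes "Vector_Spaces.linear sA t f" "Vector_Spaces.linear sA t g"
    and "\<And>vs. set vs \<subseteq> V \<Longrightarrow> f (wedge \<iota> vs) = g (wedge \<iota> vs)"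
  shows "f a = g a"
proof -
  interpret f: Vector_Spaces.linear sA t f by fact
  interpret g: Vector_Spaces.linear sA t g by fact
  have pair: "vector_space_pair sA t"
    by unfold_locales
  have "a \<in> alg.span {wedge \<iota> vs | vs. set vs \<subseteq> V}"
    by (simp add: span_wedges)
  then show ?thesis
    by (rule vector_space_pair.linear_eq_on[OF pair assms(1,2)]) (use assms(3) in auto)
qed

lemma generator_anticommute:
  assumes "u \<in> V" "v \<in> V"
  shows "\<iota> v * \<iota> u = - (\<iota> u * \<iota> v)"
proof -
  have "\<iota> (u + v) * \<iota> (u + v) = 0"
    using assms base.subspace_add[OF subspace] by (simp add: generator_square)
  then have "\<iota> v * \<iota> u + \<iota> u * \<iota> v = 0"
    using assms by (simp add: generator_add generator_square algebra_simps)
  then show ?thesis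
    by (simp add: eq_neg_iff_add_eq_0)
qed

lemma wedge_swap:
  assumes "u \<in> V" "v \<in> V"
  shows "wedge \<iota> (as @ v # u # bs) = - wedge \<iota> (as @ u # v # bs)"
proof -
  have "\<iota> v * (\<iota> u * w) = - (\<iota> u * (\<iota> v * w))" for w
    by (metis assms generator_anticommute mult.assoc mult_minus_left)
  then show ?thesis
    by (simp add: wedge_append)
qed

end

text \<open>
  Rearrangements of a list are generated by swaps of neighbours. Both the exterior product and the
  sign of a permutation in one-line notation change sign under such a swap, which makes this the
  induction principle for all reorderings below.
\<close>

lemma adjacent_swap_induct [consumes 1, case_names base swap]:
  assumes "mset xs = mset ys"
    and "P xs"
    and "\<And>as a b bs. mset (as @ a # b # bs) = mset xs \<Longrightarrow> P (as @ a # b # bs) \<Longrightarrow> P (as @ b # a # bs)"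
  shows "P ys"
  using assms
proof (induction ys arbitrary: xs P)
  case Nil
  then show ?case
    by (metis mset.simps(1) mset_zero_iff)
next
  case (Cons y ys)
  from Cons.prems(1) have "y \<in> set xs"
    by (metis list.set_intros(1) set_mset_mset)
  then obtain us vs where xs: "xs = us @ y # vs"
    by (meson split_list)
  \<comment> \<open>Once the first letter of the target is in front, the induction hypothesis rearranges the rest.\<close>
  have front: "P (y # us @ vs)"
    using Cons.prems(2,3) unfolding xs
  proof (induction us arbitrary: vs rule: rev_induct)
    case Nil
    show ?case
      using Nil.prems(1) by simp
  next
    case (snoc u us)
    have "P (us @ y # u # vs)"
      using snoc.prems(1) snoc.prems(2)[of us u y vs] by simp
    then have "P (y # us @ u # vs)"
    proof (rule snoc.IH)
      show "P (as @ b # a # bs)"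
        if "mset (as @ a # b # bs) = mset (us @ y # u # vs)" "P (as @ a # b # bs)" for as a b bs
        using that(1) snoc.prems(2)[OF _ that(2)] by simp
    qed
    then show ?case
      by simp
  qed
  show ?case
  proof (rule Cons.IH[where xs = "us @ vs" and P = "\<lambda>l. P (y # l)"])
    show "mset (us @ vs) = mset ys"
      using Cons.prems(1) xs by simp
    show "P (y # us @ vs)"
      by (fact front)
    show "P (y # as @ b # a # bs)"
      if "mset (as @ a # b # bs) = mset (us @ vs)" "P (y # as @ a # b # bs)" for as a b bs
      using Cons.prems(3)[of "y # as" a b bs] that xs by simp
  qed
qed

context exterior_algebra
begin

lemma wedge_permute:
  assumes "mset us = mset vs" "set us \<subseteq> V"
  shows "wedge \<iota> vs = wedge \<iota> us \<or> wedge \<iota> vs = - wedge \<iota> us"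
  using assms(1)
proof (induction rule: adjacent_swap_induct)
  case base
  show ?case by simp
next
  case (swap as a b bs)
  have "a \<in> V" "b \<in> V"
    using swap.hyps assms(2) mset_eq_setD by fastforce+
  then have "wedge \<iota> (as @ b # a # bs) = - wedge \<iota> (as @ a # b # bs)"
    by (rule wedge_swap)
  then show ?case
    using swap.IH by (metis minus_minus)
qed

lemma wedge_not_distinct:
  assumes "set vs \<subseteq> V" "\<not> distinct vs"
  shows "wedge \<iota> vs = 0"
proof -
  obtain as bs cs v where vs: "vs = as @ v # bs @ v # cs"
    using assms(2) not_distinct_decomp by force
  then have "v \<in> V"
    using assms(1) by simp
  then have "wedge \<iota> (v # v # as @ bs @ cs) = 0"
    by (simp add: mult.assoc[symmetric] generator_square)
  moreover have "mset vs = mset (v # v # as @ bs @ cs)"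
    by (simp add: vs)
  ultimately show ?thesis
    using wedge_permute[of vs "v # v # as @ bs @ cs"] assms(1) by (metis neg_equal_0_iff_equal)
qed

text \<open>
  Multilinear expansion. Keeping track of the length is what later shows that a product of \<open>n\<close>
  vectors from the span of fewer than \<open>n\<close> vectors vanishes, and that products of top degree form a
  line.
\<close>

lemma wedge_in_span:
  assumes "set vs \<subseteq> base.span B" "B \<subseteq> V"
  shows "wedge \<iota> vs \<in> alg.span {wedge \<iota> bs | bs. set bs \<subseteq> B \<and> length bs = length vs}"
  using assms(1)
proof (induction vs)
  case Nil
  then show ?case
    by (auto intro: alg.span_base)
next
  case (Cons v vs)
  let ?M = "\<lambda>n. {wedge \<iota> bs | bs. set bs \<subseteq> B \<and> length bs = n}"
  have left_mult: "\<iota> b * a \<in> alg.span (?M (Suc n))" if "b \<in> B" "a \<in> alg.span (?M n)" for a b n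
    using that(2)
  proof (induction rule: alg.span_induct)
    case base
    show ?case
      by (rule alg.subspaceI)
        (auto simp: algebra_simps scale_mult_right alg.span_zero intro: alg.span_add alg.span_scale)
  next
    case (step a)
    then obtain bs where "a = wedge \<iota> bs" "set bs \<subseteq> B" "length bs = n"
      by blast
    with \<open>b \<in> B\<close> show ?case
      by (intro alg.span_base CollectI exI[of _ "b # bs"]) auto
  qed
  have sub: "base.span B \<subseteq> V"
    using assms(2) subspace by (rule base.span_minimal)
  have "v \<in> base.span B"
    using Cons.prems by simp
  then have "v \<in> base.span B \<and> \<iota> v * wedge \<iota> vs \<in> alg.span (?M (Suc (length vs)))"
  proof (induction rule: base.span_induct_alt)
    case base
    have "\<iota> 0 = 0"
      using generator_add[of 0 0] base.subspace_0[OF subspace] by simp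
    then show ?case
      by (simp add: alg.span_zero base.span_zero)
  next
    case (step c b u)
    have "b \<in> V" "u \<in> V" "s c b \<in> V"
      using step sub assms(2) base.subspace_scale[OF subspace] by auto
    then have "\<iota> (s c b + u) * wedge \<iota> vs = sA c (\<iota> b * wedge \<iota> vs) + \<iota> u * wedge \<iota> vs"
      by (simp add: generator_add generator_scale distrib_right scale_mult_left)
    then show ?case
      using step(1,2) Cons left_mult[of b "wedge \<iota> vs" "length vs"]
      by (auto intro!: alg.span_add alg.span_scale base.span_add base.span_scale
          intro: base.span_base)
  qed
  then show ?case
    by simp
qed

text \<open>
  If the vectors were dependent, they would all lie in the span of a set \<open>B\<close> of fewer vectors; the
  expansion then has only products with a repeated factor from \<open>B\<close>.
\<close>

lemma wedge_nonzero_imp_independent: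
  assumes "set vs \<subseteq> V" "wedge \<iota> vs \<noteq> 0"
  shows "distinct vs \<and> base.independent (set vs)"
proof -
  obtain B where B: "B \<subseteq> set vs" "base.independent B" "set vs \<subseteq> base.span B"
    using base.maximal_independent_subset by blast
  have "length vs \<le> card B"
  proof (rule ccontr)
    assume less: "\<not> length vs \<le> card B"
    have "wedge \<iota> bs = 0" if "set bs \<subseteq> B" "length bs = length vs" for bs
    proof (rule wedge_not_distinct)
      show "set bs \<subseteq> V"
        using that B assms(1) by blast
      show "\<not> distinct bs"
        using that less card_mono[OF finite_subset[OF B(1)] that(1)] distinct_card by fastforce
    qed
    then have "{wedge \<iota> bs | bs. set bs \<subseteq> B \<and> length bs = length vs} \<subseteq> {0}"
      by blast
    then have "wedge \<iota> vs \<in> alg.span {0}"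
      using wedge_in_span[OF B(3)] B(1) assms(1) alg.span_mono by blast
    then show False
      using assms(2) by simp
  qed
  then have "card B = card (set vs)" "card (set vs) = length vs"
    using card_mono[OF _ B(1)] card_length[of vs] by auto
  then show ?thesis
    using B card_subset_eq[OF _ B(1)] card_distinct by auto
qed

text \<open>The scalar \<open>c\<close> puts \<open>0\<close>-blades and blades of positive degree on the same footing.\<close>

lemma blade_represents_iff:
  "blade_represents s V sA \<iota> n a U \<longleftrightarrow>
    (\<exists>c vs. c \<noteq> 0 \<and> length vs = n \<and> set vs \<subseteq> V \<and> a = sA c (wedge \<iota> vs) \<and> a \<noteq> 0
      \<and> U = base.span (set vs))" (is "?L \<longleftrightarrow> ?R")
proof (cases n)
  case 0
  then show ?thesis
    by (auto simp: blade_represents_def)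
next
  case (Suc m)
  show ?thesis
  proof
    assume ?L
    then show ?R
      using Suc by (auto simp: blade_represents_def intro!: exI[of _ 1])
  next
    assume ?R
    then obtain c v vs where *: "c \<noteq> 0" "length vs = m" "v \<in> V" "set vs \<subseteq> V"
        "a = sA c (wedge \<iota> (v # vs))" "a \<noteq> 0" "U = base.span (insert v (set vs))"
      using Suc by (auto simp: length_Suc_conv)
    \<comment> \<open>In positive degree the scalar is absorbed by the first vector.\<close>
    have "base.span (insert v (set vs)) = base.span (insert (s c v) (set vs))"
      unfolding base.span_eq
    proof (intro conjI)
      show "insert (s c v) (set vs) \<subseteq> base.span (insert v (set vs))"
        by (auto intro: base.span_base base.span_scale)
      have "s (inverse c) (s c v) \<in> base.span (insert (s c v) (set vs))"
        by (intro base.span_scale base.span_base) simp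
      then show "insert v (set vs) \<subseteq> base.span (insert (s c v) (set vs))"
        using \<open>c \<noteq> 0\<close> by (auto intro: base.span_base)
    qed
    moreover have "a = wedge \<iota> (s c v # vs)"
      using * by (simp add: generator_scale scale_mult_left)
    ultimately show ?L
      using * Suc base.subspace_scale[OF subspace]
      by (auto simp: blade_represents_def intro!: exI[of _ "s c v # vs"])
  qed
qed

end

section \<open>Contraction by a linear functional\<close>

text \<open>
  \<open>Tri a b c\<close> stands for the lower triangular matrix with rows \<open>(a, 0)\<close> and \<open>(b, c)\<close>.
\<close>

datatype 'r tri = Tri (upper: 'r) (lower: 'r) (corner: 'r)

instantiation tri :: (ring_1) ring_1
begin

definition "0 = Tri 0 0 0"
definition "1 = Tri 1 0 1"
definition "x + y = Tri (upper x + upper y) (lower x + lower y) (corner x + corner y)"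
definition "- x = Tri (- upper x) (- lower x) (- corner x)"
definition "x - y = Tri (upper x - upper y) (lower x - lower y) (corner x - corner y)"
definition "x * y =
  Tri (upper x * upper y) (lower x * upper y + corner x * lower y) (corner x * corner y)"

instance
  by intro_classes
    (simp_all add: zero_tri_def one_tri_def plus_tri_def uminus_tri_def minus_tri_def
      times_tri_def algebra_simps)

end

definition tri_scale :: "('k \<Rightarrow> 'r \<Rightarrow> 'r) \<Rightarrow> 'k \<Rightarrow> 'r tri \<Rightarrow> 'r tri" where
  "tri_scale t c x = Tri (t c (upper x)) (t c (lower x)) (t c (corner x))"

lemma (in unital_algebra) unital_algebra_tri: "unital_algebra (tri_scale sR)"
  by unfold_locales
    (simp_all add: tri_scale_def plus_tri_def times_tri_def scale_right_distrib
      scale_left_distrib scale_mult_left scale_mult_right)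

context exterior_algebra
begin

definition functional :: "('v \<Rightarrow> 'k) \<Rightarrow> bool" where
  "functional g \<longleftrightarrow>
    (\<forall>u\<in>V. \<forall>v\<in>V. g (u + v) = g u + g v) \<and> (\<forall>c. \<forall>v\<in>V. g (s c v) = c * g v)"

text \<open>
  The antiderivation of degree \<open>-1\<close> that extends the functional \<open>g\<close>, also called the interior
  product with \<open>g\<close>.
\<close>

definition is_contraction :: "('v \<Rightarrow> 'k) \<Rightarrow> ('a \<Rightarrow> 'a) \<Rightarrow> bool" where
  "is_contraction g D \<longleftrightarrow> Vector_Spaces.linear sA sA D \<and> D 1 = 0 \<and>
    (\<forall>v\<in>V. \<forall>a. D (\<iota> v * a) = sA (g v) a - \<iota> v * D a)"

text \<open>
  Well-definedness is the only difficulty, and the universal property supplies it. The matrix with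
  rows \<open>(v, 0)\<close> and \<open>(g(v), -v)\<close> has square \<open>0\<close>, because its lower left entry is
  \<open>g(v) v - v g(v) = 0\<close>. So \<open>v\<close> extends to an algebra homomorphism on the exterior algebra, whose
  upper left entry is the identity. Multiplicativity, read in the lower left corner, is the
  antiderivation rule.
\<close>

lemma contraction_exists:
  assumes "functional g"
  shows "\<exists>D. is_contraction g D"
proof -
  define j where "j v = Tri (\<iota> v) (sA (g v) 1) (- \<iota> v)" for v
  have j_add: "j (u + v) = j u + j v" if "u \<in> V" "v \<in> V" for u v
    using that assms
    by (simp add: j_def functional_def generator_add plus_tri_def alg.scale_left_distrib)
  have j_scale: "j (s c v) = tri_scale sA c (j v)" if "v \<in> V" for c v
    using that assms by (simp add: j_def functional_def generator_scale tri_scale_def)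
  have j_square: "j v * j v = 0" if "v \<in> V" for v
    using that
    by (simp add: j_def generator_square times_tri_def zero_tri_def scale_mult_left
        scale_mult_right)
  obtain \<phi> where \<phi>: "Vector_Spaces.linear sA (tri_scale sA) \<phi>" "\<phi> 1 = 1"
    "\<And>a b. \<phi> (a * b) = \<phi> a * \<phi> b" "\<And>v. v \<in> V \<Longrightarrow> \<phi> (\<iota> v) = j v"
    by (rule universal_property[OF alg.unital_algebra_tri j_add j_scale j_square])
      (assumption | rule that)+
  interpret \<phi>: Vector_Spaces.linear sA "tri_scale sA" \<phi>
    by fact
  have "Vector_Spaces.linear sA sA (\<lambda>a. upper (\<phi> a))"
    "Vector_Spaces.linear sA sA (\<lambda>a. lower (\<phi> a))"
    by unfold_locales (simp_all add: \<phi>.add \<phi>.scale plus_tri_def tri_scale_def)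
  note lin = this
  have "upper (\<phi> a) = a" for a
  proof (rule linear_eq_on_wedges[OF lin(1) alg.linear_ident])
    show "upper (\<phi> (wedge \<iota> vs)) = wedge \<iota> vs" if "set vs \<subseteq> V" for vs
      using that by (induction vs) (simp_all add: \<phi> one_tri_def times_tri_def j_def)
  qed
  then have "is_contraction g (\<lambda>a. lower (\<phi> a))"
    by (simp add: is_contraction_def lin \<phi> one_tri_def times_tri_def j_def scale_mult_left)
  then show ?thesis
    by blast
qed

definition contraction :: "('v \<Rightarrow> 'k) \<Rightarrow> 'a \<Rightarrow> 'a" where
  "contraction g = (SOME D. is_contraction g D)"

lemma
  assumes "functional g"
  shows linear_contraction: "Vector_Spaces.linear sA sA (contraction g)"
    and contraction_one: "contraction g 1 = 0"
    and contraction_generator_mult: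
      "v \<in> V \<Longrightarrow> contraction g (\<iota> v * a) = sA (g v) a - \<iota> v * contraction g a"
  using someI_ex[OF contraction_exists[OF assms]]
  by (auto simp: contraction_def is_contraction_def)

lemma contraction_wedge_eq_0:
  assumes "functional g" "set vs \<subseteq> V" "\<And>v. v \<in> set vs \<Longrightarrow> g v = 0"
  shows "contraction g (wedge \<iota> vs) = 0"
  using assms(2,3)
  by (induction vs) (simp_all add: assms(1) contraction_one contraction_generator_mult)

text \<open>
  Contractions are determined by their functional through the recursion on products of vectors, so
  they depend linearly on it.
\<close>

lemma contraction_linear_combination:
  assumes "functional g" "functional h" "functional k"
    and k: "\<And>v. v \<in> V \<Longrightarrow> k v = c * g v + h v"
  shows "contraction k a = sA c (contraction g a) + contraction h a"
proof (rule linear_eq_on_wedges[where a = a and t = sA and f = "contraction k"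
      and g = "\<lambda>a. sA c (contraction g a) + contraction h a"])
  interpret g: Vector_Spaces.linear sA sA "contraction g"
    using assms(1) by (rule linear_contraction)
  interpret h: Vector_Spaces.linear sA sA "contraction h"
    using assms(2) by (rule linear_contraction)
  show "Vector_Spaces.linear sA sA (contraction k)"
    using assms(3) by (rule linear_contraction)
  show "Vector_Spaces.linear sA sA (\<lambda>a. sA c (contraction g a) + contraction h a)"
    by unfold_locales (simp_all add: g.add g.scale h.add h.scale algebra_simps alg.scale_left_commute)
  show "contraction k (wedge \<iota> vs) = sA c (contraction g (wedge \<iota> vs)) + contraction h (wedge \<iota> vs)"
    if "set vs \<subseteq> V" for vs
    using that
    by (induction vs)
      (simp_all add: assms contraction_one contraction_generator_mult algebra_simps
        scale_mult_right)
qed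

section \<open>Spanning families of products\<close>

text \<open>
  The factor \<open>c\<close> is the determinant of \<open>gs\<close> with respect to \<open>bs\<close>: each product in the expansion
  of \<open>gs\<close> either repeats a factor or is a rearrangement of \<open>bs\<close>. This compares the volume elements
  of two bases.
\<close>

lemma wedge_multiple_of_top_wedge:
  assumes "set gs \<subseteq> base.span (set bs)" "set bs \<subseteq> V" "length gs = length bs"
  shows "\<exists>c. wedge \<iota> gs = sA c (wedge \<iota> bs)"
proof -
  have "wedge \<iota> cs \<in> alg.span {wedge \<iota> bs}"
    if cs: "set cs \<subseteq> set bs" "length cs = length gs" for cs
  proof (cases "distinct cs")
    case True
    then have card: "card (set cs) = length bs"
      using cs assms(3) by (simp add: distinct_card)
    then have "card (set bs) = length bs" "set cs = set bs"
      using card_mono[OF _ cs(1)] card_length[of bs] card_subset_eq[OF _ cs(1)] by auto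
    then have "mset bs = mset cs"
      using True card_distinct set_eq_iff_mset_eq_distinct by metis
    then have "wedge \<iota> cs = wedge \<iota> bs \<or> wedge \<iota> cs = - wedge \<iota> bs"
      using assms(2) by (rule wedge_permute)
    then show ?thesis
      using alg.span_neg[OF alg.span_base[of "wedge \<iota> bs" "{wedge \<iota> bs}"]]
      by (auto intro: alg.span_base)
  next
    case False
    then have "wedge \<iota> cs = 0"
      using cs assms(2) by (intro wedge_not_distinct) auto
    then show ?thesis
      by (simp add: alg.span_zero)
  qed
  then have "{wedge \<iota> cs | cs. set cs \<subseteq> set bs \<and> length cs = length gs} \<subseteq> alg.span {wedge \<iota> bs}"
    by blast
  then have "alg.span {wedge \<iota> cs | cs. set cs \<subseteq> set bs \<and> length cs = length gs}
      \<subseteq> alg.span {wedge \<iota> bs}"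
    by (rule alg.span_minimal[OF _ alg.subspace_span])
  then have "wedge \<iota> gs \<in> alg.span {wedge \<iota> bs}"
    using wedge_in_span[OF assms(1,2)] by blast
  then show ?thesis
    by (auto simp: alg.span_singleton)
qed

text \<open>
  The chosen order of each subset costs only a sign, and products with a repeated factor are \<open>0\<close>.
  The index set \<open>I\<close> is kept apart from the vectors so that the lemma applies to the basis as well
  as to the dual basis.
\<close>

lemma span_ordered_wedges:
  assumes x: "x ` I \<subseteq> V" "V \<subseteq> base.span (x ` I)"
    and ord: "\<And>S. S \<subseteq> I \<Longrightarrow> distinct (ord S) \<and> set (ord S) = S"
  shows "alg.span ((\<lambda>S. wedge \<iota> (map x (ord S))) ` Pow I) = UNIV"
proof -
  let ?M = "(\<lambda>S. wedge \<iota> (map x (ord S))) ` Pow I"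
  have index: "wedge \<iota> (map x is) \<in> alg.span ?M" if "set is \<subseteq> I" for "is"
  proof (cases "distinct is")
    case True
    then have "mset (ord (set is)) = mset is"
      using ord[OF that] set_eq_iff_mset_eq_distinct by blast
    then have "mset (map x (ord (set is))) = mset (map x is)"
      by simp
    then have "wedge \<iota> (map x is) = wedge \<iota> (map x (ord (set is)))
        \<or> wedge \<iota> (map x is) = - wedge \<iota> (map x (ord (set is)))"
      using ord[OF that] that x(1) by (intro wedge_permute) auto
    moreover have "wedge \<iota> (map x (ord (set is))) \<in> alg.span ?M"
      using that by (intro alg.span_base) auto
    ultimately show ?thesis
      by (auto intro: alg.span_neg)
  next
    case False
    then have "wedge \<iota> (map x is) = 0"
      using that x(1) by (intro wedge_not_distinct) (auto simp: distinct_map)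
    then show ?thesis
      by (simp add: alg.span_zero)
  qed
  have "wedge \<iota> vs \<in> alg.span ?M" if "set vs \<subseteq> V" for vs
  proof -
    have "wedge \<iota> bs \<in> alg.span ?M" if "set bs \<subseteq> x ` I" for bs
    proof -
      have "bs \<in> lists (x ` I)"
        using that by auto
      then have "bs \<in> map x ` lists I"
        by (simp only: lists_image)
      then show ?thesis
        using index by (auto simp: lists_eq_set)
    qed
    then have "{wedge \<iota> bs | bs. set bs \<subseteq> x ` I \<and> length bs = length vs} \<subseteq> alg.span ?M"
      by blast
    then have "alg.span {wedge \<iota> bs | bs. set bs \<subseteq> x ` I \<and> length bs = length vs} \<subseteq> alg.span ?M"
      by (rule alg.span_minimal[OF _ alg.subspace_span])
    then show ?thesis
      using wedge_in_span[OF subset_trans[OF that x(2)] x(1)] by blast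
  qed
  then have "alg.span {wedge \<iota> vs | vs. set vs \<subseteq> V} \<subseteq> alg.span ?M"
    by (intro alg.span_minimal alg.subspace_span) blast
  then show ?thesis
    unfolding span_wedges by blast
qed

end

section \<open>Coordinate functionals\<close>

lemma sum_fun_apply: "(\<Sum>i\<in>A. h i) u = (\<Sum>i\<in>A. h i u)"
  for h :: "'i \<Rightarrow> 'v \<Rightarrow> 'k::comm_monoid_add"
  by (induction A rule: infinite_finite_induct) simp_all

definition coordinate ::
    "('k::field \<Rightarrow> 'v::ab_group_add \<Rightarrow> 'v) \<Rightarrow> 'v set \<Rightarrow> 'v \<Rightarrow> 'v \<Rightarrow> 'k" where
  "coordinate s B v u = module.representation s B u v"

context vector_space
begin

lemma in_span_image_expand:
  assumes "a \<in> span (g ` A)" "finite A"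
  shows "\<exists>c. a = (\<Sum>i\<in>A. scale (c i) (g i))"
  using assms(1)
proof (induction rule: span_induct_alt)
  case base
  show ?case
    by (intro exI[of _ "\<lambda>_. 0"]) simp
next
  case (step k b a)
  then obtain i c where i: "i \<in> A" "b = g i" "a = (\<Sum>i\<in>A. scale (c i) (g i))"
    by auto
  have "(\<Sum>l\<in>A. scale (c l + (if l = i then k else 0)) (g l))
      = (\<Sum>l\<in>A. scale (c l) (g l)) + (\<Sum>l\<in>A. if l = i then scale k (g l) else 0)"
    unfolding sum.distrib[symmetric] by (intro sum.cong) (auto simp: scale_left_distrib)
  also have "\<dots> = scale k b + a"
    using i assms(2) by (simp add: sum.delta add.commute)
  finally show ?case
    by (intro exI[of _ "\<lambda>l. c l + (if l = i then k else 0)"]) simp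
qed

lemma dual_space_iff:
  "f \<in> dual_space scale \<longleftrightarrow> (\<forall>u v. f (u + v) = f u + f v) \<and> (\<forall>c v. f (scale c v) = c * f v)"
proof -
  have "vector_space ((*) :: 'a \<Rightarrow> 'a \<Rightarrow> 'a)"
    by unfold_locales (simp_all add: algebra_simps)
  then show ?thesis
    by (simp add: dual_space_def module_hom_iff_linear[symmetric] module_hom_iff
        module_iff_vector_space vector_space_axioms)
qed

lemma vector_space_dual: "vector_space dual_scale"
  by unfold_locales (simp_all add: dual_scale_def fun_eq_iff algebra_simps)

context
  fixes B
  assumes B: "finite B" "independent B" "span B = UNIV"
begin

lemma coordinate_in_dual: "coordinate scale B v \<in> dual_space scale"
  using B(2,3)
  by (simp add: dual_space_iff coordinate_def representation_add representation_scale)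

lemma coordinate_basis: "u \<in> B \<Longrightarrow> coordinate scale B v u = (if v = u then 1 else 0)"
  using B(2) by (auto simp: coordinate_def representation_basis)

lemma dual_eq_on_basis:
  assumes "f \<in> dual_space scale" "g \<in> dual_space scale" "\<And>v. v \<in> B \<Longrightarrow> f v = g v"
  shows "f = g"
proof
  fix u
  have "u \<in> span B"
    using B(3) by simp
  then show "f u = g u"
  proof (induction rule: span_induct_alt)
    case base
    show ?case
      using assms(1,2) unfolding dual_space_iff by (metis mult_zero_left scale_zero_left)
  next
    case (step c b u)
    then show ?case
      using assms unfolding dual_space_iff by simp
  qed
qed

lemma dual_expansion:
  assumes "f \<in> dual_space scale"
  shows "f = (\<Sum>v\<in>B. dual_scale (f v) (coordinate scale B v))" (is "f = ?g")
proof (rule dual_eq_on_basis[OF assms])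
  show "?g \<in> dual_space scale"
    using coordinate_in_dual
    by (simp add: dual_space_iff sum_fun_apply dual_scale_def sum.distrib sum_distrib_left
        algebra_simps)
  show "f u = ?g u" if "u \<in> B" for u
    using that B(1) by (simp add: sum_fun_apply dual_scale_def coordinate_basis if_distrib[of "(*) _"] cong: if_cong)
qed

text \<open>
  A functional is the combination of the coordinate functionals with its own values on the basis as
  coefficients. It vanishes on a part \<open>A\<close> of the basis exactly when only the coordinates belonging
  to the complement of \<open>A\<close> occur.
\<close>

lemma annihilator_span:
  assumes "A \<subseteq> B"
  shows "annihilator scale (span A) = module.span dual_scale (coordinate scale B ` (B - A))"
proof -
  interpret dual: vector_space dual_scale
    by (rule vector_space_dual)
  show ?thesis
  proof (intro equalityI subsetI)
    fix f assume f: "f \<in> annihilator scale (span A)"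
    then have "f = (\<Sum>v\<in>B. dual_scale (f v) (coordinate scale B v))"
      by (intro dual_expansion) (simp add: annihilator_def)
    also have "\<dots> = (\<Sum>v\<in>B - A. dual_scale (f v) (coordinate scale B v))"
      using B(1) f by (intro sum.mono_neutral_right) (auto simp: annihilator_def span_base)
    also have "\<dots> \<in> dual.span (coordinate scale B ` (B - A))"
      by (intro dual.span_sum dual.span_scale dual.span_base) auto
    finally show "f \<in> dual.span (coordinate scale B ` (B - A))" .
  next
    have zero: "coordinate scale B v u = 0" if "v \<in> B - A" "u \<in> span A" for v u
      using that(2)
    proof (induction rule: span_induct_alt)
      case base
      show ?case
        by (simp add: coordinate_def representation_zero)
    next
      case (step c b u)
      moreover have "b \<in> B" "v \<noteq> b"
        using step that assms by auto
      ultimately show ?case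
        using coordinate_in_dual[of v] unfolding dual_space_iff by (simp add: coordinate_basis)
    qed
    fix f assume "f \<in> dual.span (coordinate scale B ` (B - A))"
    then show "f \<in> annihilator scale (span A)"
    proof (induction rule: dual.span_induct_alt)
      case base
      show ?case
        by (simp add: annihilator_def dual_space_iff)
    next
      case (step c f g)
      then obtain v where "v \<in> B - A" "f = coordinate scale B v"
        by blast
      then show ?case
        using step(2) zero coordinate_in_dual[of v]
        by (auto simp: annihilator_def dual_space_iff dual_scale_def algebra_simps)
    qed
  qed
qed

corollary span_coordinates: "module.span dual_scale (coordinate scale B ` B) = dual_space scale"
proof -
  have "f 0 = 0" if "f \<in> dual_space scale" for f
    using that unfolding dual_space_iff by (metis mult_zero_left scale_zero_left)
  then show ?thesis
    using annihilator_span[of "{}"] by (auto simp: annihilator_def)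
qed

end

end

section \<open>Signs of one-line permutations\<close>

lemma one_line_perm_permutes:
  assumes "distinct l" "set l = {1..length l}"
  shows "one_line_perm l permutes {1..length l}"
proof (rule bij_imp_permutes)
  have "inj_on (one_line_perm l) {1..length l}"
    using assms(1) by (auto simp: inj_on_def one_line_perm_def nth_eq_iff_index_eq)
  moreover have "one_line_perm l ` {1..length l} \<subseteq> {1..length l}"
  proof -
    have "l ! (j - 1) \<in> {1..length l}" if "j \<in> {1..length l}" for j
      using that assms(2) nth_mem[of "j - 1" l] by auto
    then show ?thesis
      by (auto simp: one_line_perm_def)
  qed
  ultimately show "bij_betw (one_line_perm l) {1..length l} {1..length l}"
    by (intro bij_betw_imageI endo_inj_surj) simp_all
qed (auto simp: one_line_perm_def)

text \<open>
  Exchanging two neighbouring entries is composition on the right with the transposition of their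
  positions, which are counted from 1.
\<close>

lemma sign_one_line_perm_swap:
  assumes "distinct (as @ a # b # bs)" "set (as @ a # b # bs) = {1..length (as @ a # b # bs)}"
  shows "sign (one_line_perm (as @ b # a # bs)) = - sign (one_line_perm (as @ a # b # bs))"
proof -
  let ?p = "one_line_perm (as @ a # b # bs)"
  let ?t = "transpose (Suc (length as)) (Suc (Suc (length as)))"
  have "one_line_perm (as @ b # a # bs) = ?p \<circ> ?t"
  proof
    fix j
    consider "j = Suc (length as)" | "j = Suc (Suc (length as))"
      | "j \<notin> {Suc (length as), Suc (Suc (length as))}"
      by blast
    then show "one_line_perm (as @ b # a # bs) j = (?p \<circ> ?t) j"
    proof cases
      case 3
      moreover have "(as @ b # a # bs) ! (j - 1) = (as @ a # b # bs) ! (j - 1)" if "1 \<le> j"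
        using that 3 by (auto simp: nth_append nth_Cons')
      ultimately show ?thesis
        by (simp add: one_line_perm_def transpose_def)
    qed (simp_all add: one_line_perm_def nth_append)
  qed
  moreover have "permutation ?p"
    using one_line_perm_permutes[OF assms] permutation_permutes by blast
  ultimately show ?thesis
    using sign_compose[OF _ permutation_swap_id, of ?p] by (simp add: sign_swap_id)
qed

section \<open>The map given by complementary subsets\<close>

locale complement_map =
  E: exterior_algebra s UNIV sA \<iota> +
  F: exterior_algebra dual_scale "dual_space s" sB \<kappa> +
  H: Vector_Spaces.linear sA sB H
  for s :: "'k::field \<Rightarrow> 'v::ab_group_add \<Rightarrow> 'v"
    and sA :: "'k \<Rightarrow> 'a::ring_1 \<Rightarrow> 'a" and \<iota> :: "'v \<Rightarrow> 'a"
    and sB :: "'k \<Rightarrow> 'b::ring_1 \<Rightarrow> 'b" and \<kappa> :: "('v \<Rightarrow> 'k) \<Rightarrow> 'b"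
    and H :: "'a \<Rightarrow> 'b" +
  fixes d :: nat
    and x :: "nat \<Rightarrow> 'v"
    and xT :: "nat \<Rightarrow> ('v \<Rightarrow> 'k)"
    and ord ordT :: "nat set \<Rightarrow> nat list"
  assumes basis: "inj_on x {1..d}" "E.base.independent (x ` {1..d})"
      "E.base.span (x ` {1..d}) = UNIV"
    and dual_basis: "\<And>i. i \<in> {1..d} \<Longrightarrow> xT i \<in> dual_space s"
      "\<And>i j. i \<in> {1..d} \<Longrightarrow> j \<in> {1..d} \<Longrightarrow> xT i (x j) = (if i = j then 1 else 0)"
    and ord: "\<And>S. S \<subseteq> {1..d} \<Longrightarrow> distinct (ord S) \<and> set (ord S) = S"
    and ordT: "\<And>S. S \<subseteq> {1..d} \<Longrightarrow> distinct (ordT S) \<and> set (ordT S) = S"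
    and H_basis: "\<And>S. S \<subseteq> {1..d} \<Longrightarrow>
      H (wedge \<iota> (map x (ord S))) =
        sB (of_int (sign (one_line_perm (ord S @ ordT ({1..d} - S)))))
           (wedge \<kappa> (map xT (ordT ({1..d} - S))))"
begin

text \<open>
  The prescription for \<open>H\<close> does not depend on the chosen orders: swapping two neighbours in either
  list changes the sign of the corresponding product and the sign of the permutation. This freedom
  replaces all explicit counting of signs below.
\<close>

lemma H_index_lists:
  assumes "distinct (is @ js)" "set (is @ js) = {1..d}"
  shows "H (wedge \<iota> (map x is)) =
    sB (of_int (sign (one_line_perm (is @ js)))) (wedge \<kappa> (map xT js))"
proof -
  define Q where "Q is js \<longleftrightarrow> H (wedge \<iota> (map x is)) =
    sB (of_int (sign (one_line_perm (is @ js)))) (wedge \<kappa> (map xT js))" for "is" js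
  let ?S = "set is"
  define js0 where "js0 = ordT ({1..d} - ?S)"
  have S: "?S \<subseteq> {1..d}"
    using assms(2) by auto
  have js: "set js = {1..d} - ?S"
    using assms by auto
  have mset_is: "mset (ord ?S) = mset is" and mset_js: "mset js0 = mset js"
    using ord[OF S] ordT[OF Diff_subset, of ?S] assms(1) js
      set_eq_iff_mset_eq_distinct[of "ord ?S" "is"] set_eq_iff_mset_eq_distinct[of js0 js]
    by (auto simp: js0_def)
  have perm: "distinct l \<and> set l = {1..length l}" if "mset l = mset (is @ js)" for l
  proof -
    have l: "distinct l" "set l = {1..d}"
      using that assms mset_eq_imp_distinct_iff mset_eq_setD by metis+
    then have "length l = d"
      using distinct_card by fastforce
    with l show ?thesis
      by simp
  qed
  from mset_is have Q_is: "Q is js0"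
  proof (induction rule: adjacent_swap_induct)
    case base
    show ?case
      using H_basis[OF S] by (simp add: Q_def js0_def)
  next
    case (swap as a b bs)
    have "mset (as @ a # b # bs) + mset js0 = mset is + mset js"
      by (simp only: swap.hyps mset_is mset_js)
    then have "mset (as @ a # b # bs @ js0) = mset (is @ js)"
      by (simp add: add.assoc)
    note sgn = perm[OF this]
    have "wedge \<iota> (map x (as @ b # a # bs)) = - wedge \<iota> (map x (as @ a # b # bs))"
      using E.wedge_swap[of "x a" "x b" "map x as" "map x bs"] by simp
    then show ?case
      using swap.IH sign_one_line_perm_swap[of as a b "bs @ js0"] sgn
      by (simp add: Q_def H.neg)
  qed
  from mset_js have "Q is js"
  proof (induction rule: adjacent_swap_induct)
    case base
    show ?case
      by (rule Q_is)
  next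
    case (swap as a b bs)
    have "mset ((is @ as) @ a # b # bs) = mset (is @ js)"
      using swap.hyps mset_js by simp
    note sgn = perm[OF this]
    have "a \<in> {1..d}" "b \<in> {1..d}"
      using mset_eq_setD[OF swap.hyps] ordT[OF Diff_subset, of ?S] by (auto simp: js0_def)
    then have "wedge \<kappa> (map xT (as @ b # a # bs)) = - wedge \<kappa> (map xT (as @ a # b # bs))"
      using F.wedge_swap[of "xT a" "xT b" "map xT as" "map xT bs"] dual_basis(1) by simp
    then show ?case
      using swap.IH sign_one_line_perm_swap[of "is @ as" a b bs] sgn
      by (simp add: Q_def)
  qed
  then show ?thesis
    by (simp add: Q_def)
qed

text \<open>
  A vector is a functional on the dual space, hence contracts the exterior algebra of the dual.
\<close>

abbreviation insertion :: "'v \<Rightarrow> 'b \<Rightarrow> 'b" where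
  "insertion v \<equiv> F.contraction (\<lambda>f. f v)"

lemma functional_evaluation: "F.functional (\<lambda>f. f v)"
  by (simp add: F.functional_def dual_scale_def)

lemma linear_insertion: "Vector_Spaces.linear sB sB (insertion v)"
  by (intro F.linear_contraction functional_evaluation)

lemma insertion_linear_combination:
  "insertion (s c u + v) b = sB c (insertion u b) + insertion v b"
  by (rule F.contraction_linear_combination)
    (auto simp: functional_evaluation E.base.dual_space_iff)

text \<open>
  If \<open>i \<notin> S\<close>, list the complement of \<open>S\<close> with \<open>i\<close> in front. Contraction removes this first
  factor without a sign, and the concatenation of the two lists stays the same when \<open>i\<close> moves from
  the head of the second list to the end of the first. If \<open>i \<in> S\<close>, both sides vanish.
\<close>

lemma H_basis_mult:
  assumes S: "S \<subseteq> {1..d}" and i: "i \<in> {1..d}"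
  shows "H (wedge \<iota> (map x (ord S)) * \<iota> (x i)) = insertion (x i) (H (wedge \<iota> (map x (ord S))))"
proof -
  interpret D: Vector_Spaces.linear sB sB "insertion (x i)"
    by (rule linear_insertion)
  have vanish: "insertion (x i) (wedge \<kappa> (map xT js)) = 0" if "set js \<subseteq> {1..d} - {i}" for js
  proof (rule F.contraction_wedge_eq_0[OF functional_evaluation])
    show "set (map xT js) \<subseteq> dual_space s"
      using that dual_basis(1) by auto
    fix f assume "f \<in> set (map xT js)"
    then obtain j where "f = xT j" "j \<in> set js"
      by auto
    moreover from this have "j \<in> {1..d}" "j \<noteq> i"
      using that by blast+
    ultimately show "f (x i) = 0"
      using i dual_basis(2)[of j i] by simp
  qed
  let ?is = "ord S"
  note ord = ord[OF S]
  have append: "wedge \<iota> (map x ?is) * \<iota> (x i) = wedge \<iota> (map x (?is @ [i]))"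
    by (simp add: wedge_append)
  show ?thesis
  proof (cases "i \<in> S")
    case True
    then have "wedge \<iota> (map x (?is @ [i])) = 0"
      using ord by (intro E.wedge_not_distinct) auto
    moreover have "insertion (x i) (wedge \<kappa> (map xT (ordT ({1..d} - S)))) = 0"
      using True ordT[OF Diff_subset, of S] by (intro vanish) auto
    then have "insertion (x i) (H (wedge \<iota> (map x ?is))) = 0"
      unfolding H_basis[OF S] by (simp add: D.scale)
    ultimately show ?thesis
      by (simp add: append)
  next
    case False
    define js where "js = ordT ({1..d} - S - {i})"
    have js: "distinct js" "set js = {1..d} - S - {i}"
      using ordT[of "{1..d} - S - {i}"] by (auto simp: js_def)
    let ?c = "of_int (sign (one_line_perm (?is @ i # js)))"
    have "H (wedge \<iota> (map x ?is)) = sB ?c (wedge \<kappa> (map xT (i # js)))"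
      using js ord False i S by (intro H_index_lists) auto
    moreover have "insertion (x i) (wedge \<kappa> (map xT js)) = 0"
      using js by (intro vanish) auto
    then have "insertion (x i) (wedge \<kappa> (map xT (i # js))) = wedge \<kappa> (map xT js)"
      using dual_basis(1)[OF i] dual_basis(2)[OF i i]
      by (simp add: F.contraction_generator_mult functional_evaluation)
    moreover have "set ((?is @ [i]) @ js) = {1..d}"
      using js ord i S by auto
    then have "H (wedge \<iota> (map x (?is @ [i]))) = sB ?c (wedge \<kappa> (map xT js))"
      using H_index_lists[of "?is @ [i]" js] js ord False by simp
    ultimately show ?thesis
      unfolding append by (simp add: D.scale)
  qed
qed

lemma span_A: "E.alg.span ((\<lambda>S. wedge \<iota> (map x (ord S))) ` Pow {1..d}) = UNIV"
  using ord basis(3) by (intro E.span_ordered_wedges) auto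

text \<open>
  The key identity: \<open>H\<close> turns exterior multiplication by a vector on the right into contraction by
  this vector. Unlike the definition of \<open>H\<close>, it does not refer to a basis.
\<close>

lemma H_mult_generator: "H (a * \<iota> v) = insertion v (H a)"
proof -
  have "v \<in> E.base.span (x ` {1..d})"
    unfolding basis(3) by simp
  then show ?thesis
  proof (induction arbitrary: a rule: E.base.span_induct_alt)
    case base
    have "insertion 0 b = 0" for b
      using insertion_linear_combination[of 1 0 0 b] by simp
    moreover have "\<iota> 0 = 0"
      using E.generator_add[of 0 0] by simp
    ultimately show ?case
      by simp
  next
    case (step c u v)
    then obtain i where i: "i \<in> {1..d}" "u = x i"
      by blast
    interpret D: Vector_Spaces.linear sB sB "insertion u"
      by (rule linear_insertion)
    have "a \<in> E.alg.span ((\<lambda>S. wedge \<iota> (map x (ord S))) ` Pow {1..d})"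
      unfolding span_A by simp
    then have "H (a * \<iota> u) = insertion u (H a)"
    proof (induction rule: E.alg.span_induct_alt)
      case base
      show ?case
        by simp
    next
      case (step k w a)
      then have "H (w * \<iota> u) = insertion u (H w)"
        using H_basis_mult i by auto
      then show ?case
        using step.IH by (simp add: distrib_right E.scale_mult_left H.add H.scale D.add D.scale)
    qed
    moreover have "a * \<iota> (s c u + v) = sA c (a * \<iota> u) + a * \<iota> v"
      by (simp add: E.generator_add E.generator_scale distrib_left E.scale_mult_right)
    ultimately show ?case
      by (simp add: H.add H.scale step.IH insertion_linear_combination)
  qed
qed

lemma H_kernel_mult:
  assumes "H a = 0"
  shows "H (a * wedge \<iota> vs) = 0"
proof (induction vs rule: rev_induct)
  case Nil
  then show ?case
    using assms by simp
next
  case (snoc v vs)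
  interpret D: Vector_Spaces.linear sB sB "insertion v"
    by (rule linear_insertion)
  show ?case
    using snoc H_mult_generator[of "a * wedge \<iota> vs" v] by (simp add: wedge_append mult.assoc)
qed

text \<open>
  The kernel of \<open>H\<close> is a right ideal. Let \<open>S\<close> be of least size among the subsets with a nonzero
  coefficient in \<open>a\<close>. Multiplying \<open>a\<close> by the product over the complement of \<open>S\<close> kills every other
  term, since the remaining subsets with nonzero coefficient are not contained in \<open>S\<close>. What is
  left is a nonzero multiple of the top product, which \<open>H\<close> sends to a nonzero scalar.
\<close>

lemma H_kernel:
  assumes "H a = 0"
  shows "a = 0"
proof (rule ccontr)
  assume "a \<noteq> 0"
  let ?x = "\<lambda>S. wedge \<iota> (map x (ord S))"
  let ?P = "Pow {1..d}"
  have "\<exists>c. a = (\<Sum>S\<in>?P. sA (c S) (?x S))"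
    by (rule E.alg.in_span_image_expand) (unfold span_A, simp_all)
  then obtain c where a: "a = (\<Sum>S\<in>?P. sA (c S) (?x S))"
    by blast
  have "\<exists>S. S \<in> ?P \<and> c S \<noteq> 0"
    using \<open>a \<noteq> 0\<close> a by (metis (no_types, lifting) E.alg.scale_zero_left sum.neutral)
  then obtain S where S: "S \<in> ?P" "c S \<noteq> 0"
    and min: "\<And>T. T \<in> ?P \<and> c T \<noteq> 0 \<Longrightarrow> card S \<le> card T"
    using exists_least_iff[of "\<lambda>n. \<exists>S. S \<in> ?P \<and> c S \<noteq> 0 \<and> card S = n"]
    by (metis (no_types, lifting) linorder_not_less)
  define js where "js = ordT ({1..d} - S)"
  have js: "distinct js" "set js = {1..d} - S"
    using ordT[of "{1..d} - S"] by (auto simp: js_def)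
  let ?w = "wedge \<iota> (map x js)"
  have "sA (c T) (?x T) * ?w = 0" if T: "T \<in> ?P - {S}" for T
  proof (cases "c T = 0")
    case False
    have "\<not> T \<subset> S"
      using min[of T] T False S(1) psubset_card_mono[of S T] finite_subset[of S "{1..d}"] by auto
    with T have "\<not> T \<subseteq> S"
      by blast
    then obtain i where "i \<in> T" "i \<in> set js"
      using T unfolding js(2) by blast
    then have "\<not> distinct (map x (ord T @ js))"
      using ord[of T] T by (auto simp: distinct_map)
    then have "?x T * ?w = 0"
      using E.wedge_not_distinct[of "map x (ord T @ js)"] by (simp add: wedge_append)
    then show ?thesis
      by (simp add: E.scale_mult_left)
  qed simp
  then have "(\<Sum>T\<in>?P - {S}. sA (c T) (?x T) * ?w) = 0"
    by (rule sum.neutral[OF ballI])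
  then have "a * ?w = sA (c S) (?x S) * ?w"
    unfolding a sum_distrib_right using S(1) by (subst sum.remove[of ?P S]) simp_all
  also have "\<dots> = sA (c S) (wedge \<iota> (map x (ord S @ js)))"
    by (simp add: E.scale_mult_left wedge_append)
  finally have "H (a * ?w) = sB (c S) (H (wedge \<iota> (map x (ord S @ js))))"
    by (simp add: H.scale)
  also have "H (wedge \<iota> (map x (ord S @ js))) =
      sB (of_int (sign (one_line_perm ((ord S @ js) @ [])))) (wedge \<kappa> (map xT []))"
    using js ord[of S] S by (intro H_index_lists) auto
  finally have "sB (c S * of_int (sign (one_line_perm (ord S @ js)))) 1 = 0"
    using H_kernel_mult[OF assms] by simp
  then show False
    using S(2) by (cases "one_line_perm (ord S @ js)" rule: sign_cases) simp_all
qed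

text \<open>
  The conditions on \<open>xT\<close> leave no choice: these functionals are the coordinates of the basis.
\<close>

lemma span_dual_basis: "F.base.span (xT ` {1..d}) = dual_space s"
proof -
  let ?B = "x ` {1..d}"
  have "xT i = coordinate s ?B (x i)" if "i \<in> {1..d}" for i
  proof (rule E.base.dual_eq_on_basis[of ?B])
    show "xT i v = coordinate s ?B (x i) v" if "v \<in> ?B" for v
      using that \<open>i \<in> {1..d}\<close> basis dual_basis(2)
      by (auto simp: E.base.coordinate_basis inj_on_eq_iff)
  qed (use that basis dual_basis(1) E.base.coordinate_in_dual in auto)
  then have "xT ` {1..d} = coordinate s ?B ` ?B"
    unfolding image_image by (rule image_cong[OF refl])
  then show ?thesis
    using E.base.span_coordinates[of ?B] basis by simp
qed

lemma bij_H: "bij H"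
proof (rule bijI)
  show "inj H"
    using H_kernel by (simp add: H.inj_iff_eq_0)
  let ?y = "\<lambda>S. wedge \<kappa> (map xT (ordT S))"
  have "?y S \<in> range H" if "S \<subseteq> {1..d}" for S
  proof -
    let ?w = "wedge \<iota> (map x (ord ({1..d} - S)))"
    let ?e = "of_int (sign (one_line_perm (ord ({1..d} - S) @ ordT S)))"
    have "H ?w = sB ?e (?y S)"
      using H_basis[of "{1..d} - S"] that by (simp add: double_diff)
    then have "H (sA ?e ?w) = ?y S"
      by (simp add: H.scale flip: of_int_mult)
    then show ?thesis
      by (metis rangeI)
  qed
  then have "F.alg.span (?y ` Pow {1..d}) \<subseteq> range H"
    using H.subspace_image[OF E.alg.subspace_UNIV] by (intro F.alg.span_minimal) auto
  moreover have "F.alg.span (?y ` Pow {1..d}) = UNIV"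
    using ordT dual_basis(1) span_dual_basis by (intro F.span_ordered_wedges) auto
  ultimately show "surj H"
    by blast
qed

lemma H_one: "\<exists>c. H 1 = sB c (wedge \<kappa> (map xT [1..<Suc d]))"
proof -
  have "set [1..<Suc d] = {1..d}"
    by auto
  then have "H (wedge \<iota> (map x [])) =
      sB (of_int (sign (one_line_perm ([] @ [1..<Suc d])))) (wedge \<kappa> (map xT [1..<Suc d]))"
    by (intro H_index_lists) simp_all
  then show ?thesis
    unfolding list.map wedge_simps by blast
qed

text \<open>
  Extend the vectors \<open>vs\<close> of the blade by \<open>us\<close> to a basis. The volume element \<open>H 1\<close> is a multiple
  of the product of the new coordinate functionals, since products of top degree form a line.
  Multiplying \<open>1\<close> by the vectors \<open>vs\<close> one after another contracts it by these vectors, each of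
  which strips off exactly its own coordinate functional from the front. The coordinates belonging to
  \<open>us\<close> remain, and they span the annihilator.
\<close>

lemma H_blade:
  assumes "blade_represents s UNIV sA \<iota> n a W"
  shows "\<exists>m. blade_represents dual_scale (dual_space s) sB \<kappa> m (H a) (annihilator s W)"
proof -
  obtain c vs where blade: "c \<noteq> 0" "a = sA c (wedge \<iota> vs)" "a \<noteq> 0" "W = E.base.span (set vs)"
    using assms unfolding E.blade_represents_iff by blast
  then have vs: "distinct vs" "E.base.independent (set vs)"
    using E.wedge_nonzero_imp_independent[of vs] by auto
  define B where "B = E.base.extend_basis (set vs)"
  have B: "set vs \<subseteq> B" "E.base.independent B" "E.base.span B = UNIV"
    using E.base.extend_basis_superset[OF vs(2)] E.base.independent_extend_basis[OF vs(2)]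
      E.base.span_extend_basis[OF vs(2)] by (simp_all add: B_def)
  have card_x: "card (x ` {1..d}) = d"
    using basis(1) by (simp add: card_image)
  have "finite B" "card B \<le> d"
    using E.base.independent_span_bound[of "x ` {1..d}" B] B basis card_x by auto
  moreover have "d \<le> card B"
    using E.base.independent_span_bound[of B "x ` {1..d}"] B basis card_x \<open>finite B\<close> by auto
  ultimately have fin: "finite B" and card_B: "card B = d"
    by auto
  note coord = E.base.coordinate_in_dual[OF fin B(2,3)] E.base.coordinate_basis[OF fin B(2,3)]
  obtain us where us: "distinct us" "set us = B - set vs"
    using finite_distinct_list[of "B - set vs"] fin by auto
  define bs where "bs = vs @ us"
  have bs: "distinct bs" "set bs = B"
    using vs us B(1) by (auto simp: bs_def)
  then have "length bs = d"
    using card_B distinct_card[of bs] by simp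
  let ?f = "coordinate s B"
  have "\<exists>k. wedge \<kappa> (map xT [1..<Suc d]) = sB k (wedge \<kappa> (map ?f bs))"
  proof (rule F.wedge_multiple_of_top_wedge)
    have "F.base.span (set (map ?f bs)) = dual_space s"
      using E.base.span_coordinates[OF fin B(2,3)] bs by simp
    then show "set (map xT [1..<Suc d]) \<subseteq> F.base.span (set (map ?f bs))"
      using dual_basis(1) by auto
  qed (use coord \<open>length bs = d\<close> in auto)
  then obtain k where k: "H 1 = sB k (wedge \<kappa> (map ?f bs))"
    using H_one F.alg.scale_scale by metis
  have "H (wedge \<iota> ps) = sB k (wedge \<kappa> (map ?f qs))" if "bs = ps @ qs" for ps qs
    using that
  proof (induction ps arbitrary: qs rule: rev_induct)
    case Nil
    then show ?case
      using k by simp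
  next
    case (snoc v ps)
    interpret D: Vector_Spaces.linear sB sB "insertion v"
      by (rule linear_insertion)
    have v: "v \<in> B" "v \<notin> set qs" "set qs \<subseteq> B"
      using bs snoc.prems by auto
    have "insertion v (wedge \<kappa> (map ?f qs)) = 0"
      using v coord by (intro F.contraction_wedge_eq_0 functional_evaluation) auto
    then have "insertion v (wedge \<kappa> (map ?f (v # qs))) = wedge \<kappa> (map ?f qs)"
      using v coord by (simp add: F.contraction_generator_mult functional_evaluation)
    then show ?case
      using snoc.IH[of "v # qs"] snoc.prems H_mult_generator[of "wedge \<iota> ps" v]
      by (simp add: wedge_append D.scale)
  qed
  then have "H (wedge \<iota> vs) = sB k (wedge \<kappa> (map ?f us))"
    by (simp add: bs_def)
  then have Ha: "H a = sB (c * k) (wedge \<kappa> (map ?f us))"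
    by (simp add: blade(2) H.scale)
  have "H a \<noteq> 0"
    using H_kernel blade(3) by blast
  moreover have "c * k \<noteq> 0"
    using \<open>H a \<noteq> 0\<close> Ha by auto
  moreover have "annihilator s W = F.base.span (set (map ?f us))"
    using E.base.annihilator_span[OF fin B(2,3) B(1)] us by (simp add: blade(4))
  moreover have "set (map ?f us) \<subseteq> dual_space s"
    using coord by auto
  ultimately show ?thesis
    unfolding F.blade_represents_iff using Ha by blast
qed

end

theorem mainTheorem3:
  fixes s :: "'k::field \<Rightarrow> 'v::ab_group_add \<Rightarrow> 'v"
    and d :: nat
    and x :: "nat \<Rightarrow> 'v"
    and xT :: "nat \<Rightarrow> ('v \<Rightarrow> 'k)"
    and sA :: "'k \<Rightarrow> 'a::ring_1 \<Rightarrow> 'a" and \<iota> :: "'v \<Rightarrow> 'a"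
    and sB :: "'k \<Rightarrow> 'b::ring_1 \<Rightarrow> 'b" and \<kappa> :: "('v \<Rightarrow> 'k) \<Rightarrow> 'b"
    and ord ordT :: "nat set \<Rightarrow> nat list"
    and H :: "'a \<Rightarrow> 'b"
  assumes "vector_space s"
    and basis: "inj_on x {1..d}" "module.independent s (x ` {1..d})"
      "module.span s (x ` {1..d}) = UNIV"
    and dual_basis: "\<And>i. i \<in> {1..d} \<Longrightarrow> xT i \<in> dual_space s"
      "\<And>i j. i \<in> {1..d} \<Longrightarrow> j \<in> {1..d} \<Longrightarrow> xT i (x j) = (if i = j then 1 else 0)"
    and "exterior_algebra s UNIV sA \<iota>"
    and "exterior_algebra dual_scale (dual_space s) sB \<kappa>"
    and ord: "\<And>S. S \<subseteq> {1..d} \<Longrightarrow> distinct (ord S) \<and> set (ord S) = S"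
    and ordT: "\<And>S. S \<subseteq> {1..d} \<Longrightarrow> distinct (ordT S) \<and> set (ordT S) = S"
    and H_linear: "Vector_Spaces.linear sA sB H"
    and H_basis: "\<And>S. S \<subseteq> {1..d} \<Longrightarrow>
      H (wedge \<iota> (map x (ord S))) =
        sB (of_int (sign (one_line_perm (ord S @ ordT ({1..d} - S)))))
           (wedge \<kappa> (map xT (ordT ({1..d} - S))))"
  shows "Vector_Spaces.linear sA sB H \<and> bij H \<and>
    (\<forall>n a W. blade_represents s UNIV sA \<iota> n a W \<longrightarrow>
      (\<exists>m. blade_represents dual_scale (dual_space s) sB \<kappa> m (H a) (annihilator s W)))"
proof -
  interpret E: exterior_algebra s UNIV sA \<iota>
    by fact
  interpret F: exterior_algebra dual_scale "dual_space s" sB \<kappa>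
    by fact
  interpret H: Vector_Spaces.linear sA sB H
    by fact
  interpret complement_map s sA \<iota> sB \<kappa> H d x xT ord ordT
    by unfold_locales (fact basis dual_basis ord ordT H_basis)+
  show ?thesis
    using H_linear bij_H H_blade by blast
qed

end
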